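(* For every $k\geq1$ there is a bipartite graph $G$ such that $2\deg(G)\leq 2k\leq \mathrm{ca}(G)=t(G)$.
   Context: All graphs are finite and simple. The degeneracy $\deg(G)$ is the minimum, over all acyclic orientations of $G$, of the maximum out-degree. A caterpillar is a tree in which the non-leaf vertices form a path; a caterpillar forest is a disjoint union of caterpillars. The caterpillar arboricity $\mathrm{ca}(G)$ is the minimum number of caterpillar forests (subgraphs of $G$) whose edge sets cover $E(G)$. The track-number $t(G)$ is the minimum number of interval graphs (subgraphs of $G$, where an interval graph is the intersection graph of a finite family of intervals of the real line) whose edge sets cover $E(G)$. *)

theory Defs
  imports
    "HOL-Analysis.Analysis"
    "Graph_Theory.Graph_Theory"
begin

text \<open>
  A finite simple graph is a \<^locale>\<open>pair_graph\<close>: a finite vertex set together with a symmetric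
  irreflexive relation \<^const>\<open>parcs\<close>, an edge \<open>uv\<close> being the two arcs \<open>(u,v)\<close> and \<open>(v,u)\<close>.
\<close>

definition bipartite :: "'a pair_pre_digraph \<Rightarrow> bool" where
  "bipartite G \<longleftrightarrow>
    (\<exists>U W. pverts G = U \<union> W \<and> U \<inter> W = {} \<and> parcs G \<subseteq> U \<times> W \<union> W \<times> U)"

definition acyclic_orientation :: "'a pair_pre_digraph \<Rightarrow> 'a rel \<Rightarrow> bool" where
  "acyclic_orientation G D \<longleftrightarrow> D \<union> D\<inverse> = parcs G \<and> D \<inter> D\<inverse> = {} \<and> acyclic D"

text \<open>The inserted \<open>0\<close> only matters for the graph without vertices.\<close>

definition max_out_degree :: "'a set \<Rightarrow> 'a rel \<Rightarrow> nat" where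
  "max_out_degree V D = Max (insert 0 ((\<lambda>v. card (D `` {v})) ` V))"

definition degeneracy :: "'a pair_pre_digraph \<Rightarrow> nat" where
  "degeneracy G = (LEAST d. \<exists>D. acyclic_orientation G D \<and> max_out_degree (pverts G) D = d)"

text \<open>
  The library's \<^const>\<open>forest\<close> and \<^const>\<open>tree\<close> are notions for directed graphs: on a symmetric
  graph, every edge traversed back and forth counts as a cycle. The cycles of a simple graph are
  the directed cycles of length at least three.
\<close>

definition simple_tree :: "'a pair_pre_digraph \<Rightarrow> bool" where
  "simple_tree T \<longleftrightarrow> pair_graph T \<and> Digraph_Component.connected (with_proj T) \<and>
    \<not> (\<exists>p. pre_digraph.cycle (with_proj T) p \<and> 3 \<le> length p)"

text \<open>The empty graph counts as a path, since the tree with a single edge has no non-leaf vertices.\<close>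

definition path_graph :: "('a, 'b) pre_digraph \<Rightarrow> bool" where
  "path_graph P \<longleftrightarrow> (\<exists>vs. distinct vs \<and> verts P = set vs \<and>
    arcs_ends P = {(vs ! i, vs ! j) | i j.
      i < length vs \<and> j < length vs \<and> (j = Suc i \<or> i = Suc j)})"

definition leaf :: "'a pair_pre_digraph \<Rightarrow> 'a \<Rightarrow> bool" where
  "leaf G v \<longleftrightarrow> v \<in> pverts G \<and> out_degree (with_proj G) v = 1"

definition caterpillar :: "'a pair_pre_digraph \<Rightarrow> bool" where
  "caterpillar T \<longleftrightarrow> simple_tree T \<and>
    path_graph (with_proj T \<restriction> {v \<in> pverts T. \<not> leaf T v})"

definition caterpillar_forest :: "'a pair_pre_digraph \<Rightarrow> bool" where
  "caterpillar_forest F \<longleftrightarrow> pair_graph F \<and>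
    (\<exists>\<T>. (\<forall>T\<in>\<T>. caterpillar T) \<and> disjoint_family_on pverts \<T> \<and>
      pverts F = (\<Union>T\<in>\<T>. pverts T) \<and> parcs F = (\<Union>T\<in>\<T>. parcs T))"

definition interval_graph :: "'a pair_pre_digraph \<Rightarrow> bool" where
  "interval_graph H \<longleftrightarrow> pair_graph H \<and>
    (\<exists>I :: 'a \<Rightarrow> real set. (\<forall>v\<in>pverts H. is_interval (I v) \<and> I v \<noteq> {}) \<and>
      (\<forall>u\<in>pverts H. \<forall>v\<in>pverts H. u \<noteq> v \<longrightarrow> ((u, v) \<in> parcs H \<longleftrightarrow> I u \<inter> I v \<noteq> {})))"

text \<open>
  The graphs in a cover are arbitrary (not necessarily induced or spanning) subgraphs, and they
  may overlap in edges.
\<close>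

definition cover_number :: "('a pair_pre_digraph \<Rightarrow> bool) \<Rightarrow> 'a pair_pre_digraph \<Rightarrow> nat" where
  "cover_number \<C> G = (LEAST n. \<exists>\<H>. finite \<H> \<and> card \<H> = n \<and>
    (\<forall>H\<in>\<H>. subgraph (with_proj H) (with_proj G) \<and> \<C> H) \<and> (\<Union>H\<in>\<H>. parcs H) = parcs G)"

definition caterpillar_arboricity :: "'a pair_pre_digraph \<Rightarrow> nat" where
  "caterpillar_arboricity G = cover_number caterpillar_forest G"

definition track_number :: "'a pair_pre_digraph \<Rightarrow> nat" where
  "track_number G = cover_number interval_graph G"

end

theory Submission
  imports Defs
begin

text \<open>
  The graph has three layers: \<open>k\<close> vertices \<open>A\<close>, a large set \<open>B\<close> completely joined to \<open>A\<close>, and, for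
  every \<open>k\<close>-subset \<open>S\<close> of \<open>B\<close>, many vertices in \<open>C\<close> joined exactly to \<open>S\<close>. Directing all edges
  from \<open>C\<close> to \<open>B\<close> and from \<open>B\<close> to \<open>A\<close> gives out-degree at most \<open>k\<close>, and splitting the edges between
  consecutive layers into \<open>k\<close> star forests each gives a cover by \<open>2k\<close> graphs that are both caterpillar
  forests and interval graphs.

  For the lower bound, caterpillar forests and triangle-free interval graphs contain no 4-cycle,
  and each of their vertices has at most two neighbours that are not leaves. In a cover by fewer
  than \<open>2k\<close> of them, all but a bounded number of vertices \<open>b\<close> of \<open>B\<close> are therefore leaves in every
  graph that contains an edge from \<open>b\<close> to \<open>A\<close>. Such a \<open>b\<close> uses at least \<open>k\<close> graphs for its edges to
  \<open>A\<close> and none of these for its edges to \<open>C\<close>. By pigeonhole, some \<open>k\<close> such vertices use the same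
  graphs for \<open>A\<close>. Each of their many common neighbours in \<open>C\<close> has \<open>k\<close> edges to them in fewer than \<open>k\<close>
  graphs, so two edges lie in the same graph; two common neighbours for which this
  happens in the same way yield a 4-cycle.
\<close>

section \<open>Thin relations: the common features of both kinds of covering graphs\<close>

text \<open>The last clause bounds by two the neighbours of \<open>v\<close> that are not leaves
  hanging on \<open>v\<close>. It speaks of subsets \<open>W\<close> with three elements because
  \<open>card\<close> is \<open>0\<close> on infinite sets, so that a bound on the cardinality alone
  would admit infinitely many such neighbours.\<close>

definition thin :: "'a rel \<Rightarrow> bool" where
  "thin R \<longleftrightarrow> sym R \<and>
    (\<forall>a b c d. (a, b) \<in> R \<and> (b, c) \<in> R \<and> (c, d) \<in> R \<and> (d, a) \<in> R \<longrightarrow> a = c \<or> b = d) \<and>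
    (\<forall>v W. W \<subseteq> {w. (v, w) \<in> R \<and> (\<exists>u. u \<noteq> v \<and> (w, u) \<in> R)} \<longrightarrow> card W \<noteq> 3)"

lemma thin_symD: "thin R \<Longrightarrow> (a, b) \<in> R \<Longrightarrow> (b, a) \<in> R"
  unfolding thin_def by (elim conjE symE)

lemma thin_no_C4:
  "thin R \<Longrightarrow> (a, b) \<in> R \<Longrightarrow> (b, c) \<in> R \<Longrightarrow> (c, d) \<in> R \<Longrightarrow> (d, a) \<in> R \<Longrightarrow> a = c \<or> b = d"
  unfolding thin_def by (elim conjE) simp

lemma thin_card_le:
  assumes "thin R"
  shows "card {w. (v, w) \<in> R \<and> (\<exists>u. u \<noteq> v \<and> (w, u) \<in> R)} \<le> 2"
proof (rule ccontr)
  assume "\<not> ?thesis"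
  then have "3 \<le> card {w. (v, w) \<in> R \<and> (\<exists>u. u \<noteq> v \<and> (w, u) \<in> R)}" by simp
  then obtain W where "W \<subseteq> {w. (v, w) \<in> R \<and> (\<exists>u. u \<noteq> v \<and> (w, u) \<in> R)}" "card W = 3"
    by (meson obtain_subset_with_card_n)
  with assms show False unfolding thin_def by blast
qed

text \<open>The patterns forbidden by \<open>thin\<close> are connected. By \<open>same\<close>, an
  arc starting at a vertex of one member of the family belongs to that member, so each pattern lies
  inside a single member.\<close>

lemma thin_disjoint_Union:
  assumes thin: "\<And>T. T \<in> \<T> \<Longrightarrow> thin (parcs T)"
    and wf: "\<And>T. T \<in> \<T> \<Longrightarrow> pair_wf_digraph T"
    and disj: "disjoint_family_on pverts \<T>"
  shows "thin (\<Union>T\<in>\<T>. parcs T)"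
proof -
  have same: "(b, c) \<in> parcs T"
    if "T \<in> \<T>" "b \<in> pverts T" and bc: "(b, c) \<in> (\<Union>T\<in>\<T>. parcs T)" for T b c
  proof -
    obtain T' where T': "T' \<in> \<T>" "(b, c) \<in> parcs T'" using bc by blast
    then have "b \<in> pverts T'" using wf pair_wf_digraph.in_arcsD1 by metis
    then have "T' = T" using disj that T' unfolding disjoint_family_on_def by blast
    with T' show ?thesis by simp
  qed
  show ?thesis
    unfolding thin_def
  proof (intro conjI allI impI)
    show "sym (\<Union>T\<in>\<T>. parcs T)"
    proof (rule symI)
      fix a b assume "(a, b) \<in> (\<Union>T\<in>\<T>. parcs T)"
      then obtain T where "T \<in> \<T>" "(a, b) \<in> parcs T" by (rule UN_E)
      then show "(b, a) \<in> (\<Union>T\<in>\<T>. parcs T)" using thin_symD[OF thin] by (intro UN_I)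
    qed
  next
    fix a b c d
    assume *: "(a, b) \<in> (\<Union>T\<in>\<T>. parcs T) \<and> (b, c) \<in> (\<Union>T\<in>\<T>. parcs T) \<and>
      (c, d) \<in> (\<Union>T\<in>\<T>. parcs T) \<and> (d, a) \<in> (\<Union>T\<in>\<T>. parcs T)"
    then obtain T where T: "T \<in> \<T>" "(a, b) \<in> parcs T" by blast
    note in2 = pair_wf_digraph.in_arcsD2[OF wf[OF T(1)]]
    have "(b, c) \<in> parcs T" using same[OF T(1) in2[OF T(2)]] * by blast
    moreover from this have "(c, d) \<in> parcs T" using same[OF T(1) in2] * by blast
    moreover from this have "(d, a) \<in> parcs T" using same[OF T(1) in2] * by blast
    ultimately show "a = c \<or> b = d" using thin_no_C4[OF thin[OF T(1)] T(2)] by blast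
  next
    fix v W
    assume W: "W \<subseteq> {w. (v, w) \<in> (\<Union>T\<in>\<T>. parcs T) \<and> (\<exists>u. u \<noteq> v \<and> (w, u) \<in> (\<Union>T\<in>\<T>. parcs T))}"
    show "card W \<noteq> 3"
    proof
      assume c3: "card W = 3"
      then obtain w where "w \<in> W" by fastforce
      then obtain T where T: "T \<in> \<T>" "(v, w) \<in> parcs T" using W by blast
      then have v: "v \<in> pverts T" using wf pair_wf_digraph.in_arcsD1 by metis
      have "W \<subseteq> {w. (v, w) \<in> parcs T \<and> (\<exists>u. u \<noteq> v \<and> (w, u) \<in> parcs T)}"
      proof
        fix x assume "x \<in> W"
        then obtain u where u: "(v, x) \<in> (\<Union>T\<in>\<T>. parcs T)" "u \<noteq> v"
          "(x, u) \<in> (\<Union>T\<in>\<T>. parcs T)" using W by blast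
        have vx: "(v, x) \<in> parcs T" by (rule same[OF T(1) v u(1)])
        then have "(x, u) \<in> parcs T"
          using same[OF T(1) _ u(3)] pair_wf_digraph.in_arcsD2[OF wf[OF T(1)]] by blast
        with vx u(2) show "x \<in> {w. (v, w) \<in> parcs T \<and> (\<exists>u. u \<noteq> v \<and> (w, u) \<in> parcs T)}" by blast
      qed
      then show False using thin[OF T(1)] c3 unfolding thin_def by blast
    qed
  qed
qed

section \<open>Caterpillars and caterpillar forests\<close>

lemma path_graph_card_neighbours:
  assumes "path_graph P"
  shows "finite {w. (v, w) \<in> arcs_ends P} \<and> card {w. (v, w) \<in> arcs_ends P} \<le> 2"
proof -
  obtain vs where vs: "distinct vs" "arcs_ends P = {(vs ! i, vs ! j) | i j.
      i < length vs \<and> j < length vs \<and> (j = Suc i \<or> i = Suc j)}"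
    using assms unfolding path_graph_def by blast
  show ?thesis
  proof (cases "\<exists>i<length vs. v = vs ! i")
    case True
    then obtain i where i: "i < length vs" "v = vs ! i" by blast
    \<comment> \<open>For \<open>i = 0\<close> the index \<open>i - 1\<close> is \<open>0\<close>,
      and at the end of the list \<open>vs ! Suc i\<close> is unspecified. Both are harmless, as
      only an upper bound is wanted.\<close>
    have "{w. (v, w) \<in> arcs_ends P} \<subseteq> {vs ! Suc i, vs ! (i - 1)}"
      using i vs nth_eq_iff_index_eq by fastforce
    moreover have "card {vs ! Suc i, vs ! (i - 1)} \<le> 2" by (simp add: card_insert_if)
    ultimately show ?thesis by (meson card_mono finite.emptyI finite.insertI finite_subset le_trans)
  next
    case False
    then have "{w. (v, w) \<in> arcs_ends P} = {}" using vs by auto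
    then show ?thesis by simp
  qed
qed

lemma not_leafI:
  assumes "(w, u) \<in> parcs G" "(w, v) \<in> parcs G" "u \<noteq> v"
  shows "\<not> leaf G w"
proof
  assume "leaf G w"
  then have "card {e \<in> parcs G. fst e = w} = 1"
    unfolding leaf_def out_degree_def out_arcs_def by simp
  then obtain e where "{e \<in> parcs G. fst e = w} = {e}" by (auto simp: card_1_singleton_iff)
  moreover have "(w, u) \<in> {e \<in> parcs G. fst e = w}" "(w, v) \<in> {e \<in> parcs G. fst e = w}"
    using assms by auto
  ultimately show False using assms(3) by auto
qed

text \<open>A 4-cycle contradicts acyclicity. A vertex \<open>v\<close> with two neighbours is no
  leaf, so its non-leaf neighbours are its neighbours in the path induced on the non-leaves, and
  there are at most two of them.\<close>

lemma thin_caterpillar: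
  assumes "caterpillar T"
  shows "thin (parcs T)"
proof -
  from assms have pg: "pair_graph T"
    and acyc: "\<And>p. pre_digraph.cycle (with_proj T) p \<Longrightarrow> \<not> 3 \<le> length p"
    and path: "path_graph (with_proj T \<restriction> {v \<in> pverts T. \<not> leaf T v})"
    unfolding caterpillar_def simple_tree_def by auto
  interpret T: pair_graph T by fact
  have symT: "sym (parcs T)" using T.pair_sym_arcs by (simp add: symmetric_def)
  show ?thesis
    unfolding thin_def
  proof (intro conjI allI impI)
    show "sym (parcs T)" by fact
  next
    fix a b c d
    assume *: "(a, b) \<in> parcs T \<and> (b, c) \<in> parcs T \<and> (c, d) \<in> parcs T \<and> (d, a) \<in> parcs T"
    show "a = c \<or> b = d"
    proof (rule ccontr)
      assume ne: "\<not> ?thesis"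
      have "T.cycle [(a, b), (b, c), (c, d), (d, a)]"
        unfolding T.cycle_def T.awalk_def using * ne
        by (auto intro!: exI[of _ a] dest: T.in_arcsD1 T.no_loops')
      then show False using acyc by fastforce
    qed
  next
    fix v W
    assume W: "W \<subseteq> {w. (v, w) \<in> parcs T \<and> (\<exists>u. u \<noteq> v \<and> (w, u) \<in> parcs T)}"
    show "card W \<noteq> 3"
    proof
      assume c3: "card W = 3"
      then obtain x y where xy: "x \<in> W" "y \<in> W" "x \<noteq> y"
        by (auto simp: card_3_iff)
      have v: "\<not> leaf T v" by (rule not_leafI[of v x T y]) (use xy W in auto)
      have w: "\<not> leaf T w" if "w \<in> W" for w
      proof -
        obtain u where "u \<noteq> v" "(w, u) \<in> parcs T" "(v, w) \<in> parcs T" using W \<open>w \<in> W\<close> by blast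
        then show ?thesis using symT by (metis not_leafI symD)
      qed
      have "W \<subseteq> {w. (v, w) \<in> arcs_ends (with_proj T \<restriction> {v \<in> pverts T. \<not> leaf T v})}"
        using W v w by (auto simp: arcs_ends_conv induce_subgraph_def image_iff
            dest: T.in_arcsD1 T.in_arcsD2)
      then have "card W \<le> 2"
        using path_graph_card_neighbours[OF path, of v] card_mono le_trans by meson
      with c3 show False by simp
    qed
  qed
qed

lemma thin_caterpillar_forest:
  assumes "caterpillar_forest F"
  shows "thin (parcs F)"
proof -
  obtain \<T> where \<T>: "\<forall>T\<in>\<T>. caterpillar T" "disjoint_family_on pverts \<T>"
    "parcs F = (\<Union>T\<in>\<T>. parcs T)"
    using assms unfolding caterpillar_forest_def by (elim conjE exE)
  have "pair_wf_digraph T" if "T \<in> \<T>" for T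
  proof -
    interpret pair_graph T
      using \<T>(1) that by (simp add: caterpillar_def simple_tree_def)
    show ?thesis ..
  qed
  then show ?thesis
    unfolding \<T>(3) using \<T>(1,2) by (intro thin_disjoint_Union thin_caterpillar) auto
qed

section \<open>Triangle-free interval graphs\<close>

lemma disjoint_intervals_cases:
  fixes I J :: "real set"
  assumes "is_interval I" "is_interval J" "I \<inter> J = {}"
  shows "(\<forall>x\<in>I. \<forall>y\<in>J. x < y) \<or> (\<forall>x\<in>I. \<forall>y\<in>J. y < x)"
proof (rule ccontr)
  assume "\<not> ?thesis"
  \<comment> \<open>The larger of \<open>x'\<close> and \<open>y\<close> will lie in both
    intervals.\<close>
  then obtain x y x' y' where *: "x \<in> I" "y \<in> J" "y \<le> x" "x' \<in> I" "y' \<in> J" "x' \<le> y'"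
    by (meson not_less)
  have I: "z \<in> I" if "x' \<le> z" "z \<le> x" for z using * that assms(1) mem_is_interval_1_I by blast
  have J: "z \<in> J" if "y \<le> z" "z \<le> y'" for z using * that assms(2) mem_is_interval_1_I by blast
  show False
  proof (cases "x' \<le> y")
    case True
    then show False using I[of y] * assms(3) by blast
  next
    case False
    then show False using J[of x'] * assms(3) by auto
  qed
qed

text \<open>Without triangles, the intervals of two neighbours of a vertex are disjoint, hence
  ordered along the line. In a 4-cycle, two opposite intervals would both span the gap between the
  other two and so meet. Of three neighbours of \<open>v\<close>, the middle one lies within the
  interval of \<open>v\<close>, so a further neighbour of it would meet \<open>v\<close> as well and
  close a triangle.\<close>

lemma thin_interval_graph:
  assumes "interval_graph H"
    and triangle_free: "\<And>a b c. (a, b) \<in> parcs H \<Longrightarrow> (b, c) \<in> parcs H \<Longrightarrow> (a, c) \<notin> parcs H"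
  shows "thin (parcs H)"
proof -
  obtain I :: "'a \<Rightarrow> real set" where pg: "pair_graph H"
    and I: "\<forall>v\<in>pverts H. is_interval (I v) \<and> I v \<noteq> {}"
      "\<forall>u\<in>pverts H. \<forall>v\<in>pverts H. u \<noteq> v \<longrightarrow> ((u, v) \<in> parcs H \<longleftrightarrow> I u \<inter> I v \<noteq> {})"
    using assms(1) unfolding interval_graph_def by (elim conjE exE)
  have int: "is_interval (I v)" if "v \<in> pverts H" for v using I(1) that by simp
  have adj: "(u, v) \<in> parcs H \<longleftrightarrow> I u \<inter> I v \<noteq> {}"
    if "u \<in> pverts H" "v \<in> pverts H" "u \<noteq> v" for u v using I(2) that by simp
  interpret H: pair_graph H by fact
  have symH: "(v, u) \<in> parcs H" if "(u, v) \<in> parcs H" for u v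
    using that H.pair_sym_arcs by (simp add: symmetric_def symD)
  note V = H.in_arcsD1 H.in_arcsD2
  have meet: "I u \<inter> I v \<noteq> {}" if "(u, v) \<in> parcs H" for u v
    using that adj V H.no_loops' by metis
  have disj: "I u \<inter> I w = {}" if "(v, u) \<in> parcs H" "(v, w) \<in> parcs H" "u \<noteq> w" for u v w
    using that adj V symH triangle_free by meson
  have side: "(\<forall>x\<in>I u. \<forall>y\<in>I w. x < y) \<or> (\<forall>x\<in>I u. \<forall>y\<in>I w. y < x)"
    if "(v, u) \<in> parcs H" "(v, w) \<in> parcs H" "u \<noteq> w" for u v w
    using disjoint_intervals_cases disj[OF that] int V that by metis
  show ?thesis
    unfolding thin_def
  proof (intro conjI allI impI)
    show "sym (parcs H)" using symH by (rule symI)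
  next
    fix a b c d
    assume *: "(a, b) \<in> parcs H \<and> (b, c) \<in> parcs H \<and> (c, d) \<in> parcs H \<and> (d, a) \<in> parcs H"
    show "a = c \<or> b = d"
    proof (rule ccontr)
      assume ne: "\<not> ?thesis"
      have cross: False
        if lt: "\<forall>x\<in>I a. \<forall>y\<in>I c. x < y"
          and e: "(a, b) \<in> parcs H" "(b, c) \<in> parcs H" "(c, d) \<in> parcs H" "(d, a) \<in> parcs H"
          and "a \<noteq> c" "b \<noteq> d" for a b c d
      proof -
        obtain p where p: "p \<in> I a" "p \<in> I b" using meet[OF e(1)] by blast
        obtain q where q: "q \<in> I b" "q \<in> I c" using meet[OF e(2)] by blast
        obtain r where r: "r \<in> I c" "r \<in> I d" using meet[OF e(3)] by blast
        obtain s where s: "s \<in> I d" "s \<in> I a" using meet[OF e(4)] by blast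
        have lts: "p < q" "p < r" "s < q" "s < r" using lt p q r s by auto
        \<comment> \<open>Both \<open>p\<close> and \<open>s\<close> lie in \<open>I a\<close>, to
          the left of \<open>q\<close> and \<open>r\<close> in \<open>I c\<close>, so the larger of
          them lies between the ends \<open>p\<close>, \<open>q\<close> in \<open>I b\<close> and
          between \<open>s\<close>, \<open>r\<close> in \<open>I d\<close>.\<close>
        have "max p s \<in> I b"
          using mem_is_interval_1_I[of "I b" p q "max p s"] int V(2)[OF e(1)] p q lts by auto
        moreover have "max p s \<in> I d"
          using mem_is_interval_1_I[of "I d" s r "max p s"] int V(2)[OF e(3)] s r lts by auto
        moreover have "I b \<inter> I d = {}"
          using disj[of a b d] e symH \<open>b \<noteq> d\<close> by blast
        ultimately show False by blast
      qed
      have "(\<forall>x\<in>I a. \<forall>y\<in>I c. x < y) \<or> (\<forall>x\<in>I c. \<forall>y\<in>I a. x < y)"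
        using side[of b a c] * ne symH by blast
      then show False using cross[of a c b d] cross[of c a d b] * ne by blast
    qed
  next
    fix v W
    assume W: "W \<subseteq> {w. (v, w) \<in> parcs H \<and> (\<exists>u. u \<noteq> v \<and> (w, u) \<in> parcs H)}"
    define before where "before u w \<longleftrightarrow> (\<forall>p\<in>I u. \<forall>q\<in>I w. p < q)" for u w
    have middle: False
      if xyz: "x \<in> W" "y \<in> W" "z \<in> W" and ne: "y \<noteq> x" "y \<noteq> z"
        and lt: "before x y" "before y z" for x y z
    proof -
      obtain u where e: "(v, x) \<in> parcs H" "(v, y) \<in> parcs H" "(v, z) \<in> parcs H"
        "u \<noteq> v" "(y, u) \<in> parcs H" using xyz W by blast
      obtain p where p: "p \<in> I v" "p \<in> I x" using meet[OF e(1)] by blast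
      obtain q where q: "q \<in> I v" "q \<in> I z" using meet[OF e(3)] by blast
      obtain r where r: "r \<in> I y" "r \<in> I u" using meet[OF e(5)] by blast
      have "p \<le> r" "r \<le> q" using lt p q r by (auto simp: before_def intro: less_imp_le)
      then have "r \<in> I v"
        using mem_is_interval_1_I[of "I v" p q r] int V(1)[OF e(1)] p q by auto
      moreover have "I v \<inter> I u = {}" using disj[of y v u] e symH by blast
      ultimately show False using r by blast
    qed
    show "card W \<noteq> 3"
    proof
      assume "card W = 3"
      then obtain x y z where xyz: "x \<in> W" "y \<in> W" "z \<in> W" "x \<noteq> y" "y \<noteq> z" "x \<noteq> z"
        by (auto simp: card_3_iff)
      then have e: "(v, x) \<in> parcs H" "(v, y) \<in> parcs H" "(v, z) \<in> parcs H" using W by auto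
      have "before x y \<or> before y x"
        unfolding before_def using side e xyz by blast
      moreover have "before y z \<or> before z y"
        unfolding before_def using side e xyz by blast
      moreover have "before x z \<or> before z x"
        unfolding before_def using side e xyz by blast
      \<comment> \<open>However the three comparisons turn out, two of them form a chain; the six
        instances are the possible chains.\<close>
      ultimately show False
        using middle[of x y z] middle[of x z y] middle[of y x z] middle[of y z x]
          middle[of z x y] middle[of z y x] xyz by metis
    qed
  qed
qed

section \<open>Star forests\<close>

text \<open>\<open>L\<close> holds the leaves and \<open>f\<close> sends each leaf to its centre.
  The fibres of \<open>f\<close> are stars once \<open>L\<close> is disjoint from its image, which
  the lemmas about it assume.\<close>

definition star_forest :: "'a set \<Rightarrow> ('a \<Rightarrow> 'a) \<Rightarrow> 'a pair_pre_digraph" where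
  "star_forest L f = \<lparr> pverts = L \<union> f ` L,
    parcs = (\<lambda>c. (c, f c)) ` L \<union> (\<lambda>c. (f c, c)) ` L \<rparr>"

lemma star_forest_simps [simp]:
  "pverts (star_forest L f) = L \<union> f ` L"
  "parcs (star_forest L f) = (\<lambda>c. (c, f c)) ` L \<union> (\<lambda>c. (f c, c)) ` L"
  by (simp_all add: star_forest_def)

lemma star_forest_arc_iff:
  "(u, v) \<in> parcs (star_forest L f) \<longleftrightarrow> u \<in> L \<and> v = f u \<or> v \<in> L \<and> u = f v"
  by auto

lemma pair_graph_star_forest:
  assumes "finite L" "L \<inter> f ` L = {}"
  shows "pair_graph (star_forest L f)"
proof
  show "symmetric (with_proj (star_forest L f))"
    unfolding symmetric_def by (auto intro!: symI)
  have "f c \<noteq> c" if "c \<in> L" for c using assms(2) that by force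
  then show "fst e \<noteq> snd e" if "e \<in> parcs (star_forest L f)" for e
    using that by fastforce
qed (use assms in auto)

text \<open>Walks in a star return to \<open>z\<close> in every second step, which rules out long
  cycles. \<open>L\<close> must be nonempty because a connected graph has a vertex.\<close>

lemma caterpillar_star:
  assumes "finite L" "z \<notin> L" "L \<noteq> {}"
  shows "caterpillar (star_forest L (\<lambda>_. z))"
proof -
  let ?S = "star_forest L (\<lambda>_. z)"
  have pg: "pair_graph ?S" by (rule pair_graph_star_forest) (use assms in auto)
  interpret S: pair_graph ?S by fact
  have fz: "(\<lambda>_. z) ` L = {z}" using assms(3) by auto
  have toz: "v \<rightarrow>\<^sup>*\<^bsub>with_proj ?S\<^esub> z" "z \<rightarrow>\<^sup>*\<^bsub>with_proj ?S\<^esub> v" if "v \<in> pverts ?S" for v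
    using that fz by auto
  have "Digraph_Component.connected (with_proj ?S)"
    unfolding connected_def strongly_connected_def
  proof (intro conjI ballI)
    show "verts (with_proj (mk_symmetric (with_proj ?S))) \<noteq> {}" using assms(3) by simp
    fix u v
    assume "u \<in> verts (with_proj (mk_symmetric (with_proj ?S)))"
      "v \<in> verts (with_proj (mk_symmetric (with_proj ?S)))"
    then have "u \<in> pverts ?S" "v \<in> pverts ?S" by simp_all
    then have "u \<rightarrow>\<^sup>*\<^bsub>with_proj ?S\<^esub> v" by (blast intro: S.reachable_trans toz)
    then show "u \<rightarrow>\<^sup>*\<^bsub>with_proj (mk_symmetric (with_proj ?S))\<^esub> v"
      by (rule S.reachable_mk_symmetricI)
  qed
  moreover have "\<not> (S.cycle p \<and> 3 \<le> length p)" for p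
  proof
    assume "S.cycle p \<and> 3 \<le> length p"
    then obtain u where p: "set p \<subseteq> parcs ?S" "pcas u p u" "distinct (tl (pawalk_verts u p))"
      and "3 \<le> length p" unfolding S.cycle_def S.awalk_def by auto
    then obtain e1 e2 e3 ps where "p = e1 # e2 # e3 # ps"
      by (metis Suc_le_length_iff numeral_3_eq_3)
    then obtain x y w t where pe: "p = (u, y) # (y, w) # (w, t) # ps" "pcas t ps u"
      using p(2) by (cases e1; cases e2; cases e3) auto
    \<comment> \<open>Distinctness is known only for the tail of the vertex list, which omits the
      first \<open>u\<close>; the closing vertex of the cycle supplies \<open>u\<close>
      again.\<close>
    have "last (pawalk_verts t ps) = u" if "pcas t ps u" for t
      using that by (induction ps arbitrary: t) (auto split: prod.splits)
    then have "u \<in> set (pawalk_verts t ps)" using pe(2) last_in_set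
      by (metis list.distinct(1) pawalk_verts.simps list.exhaust)
    moreover have "t \<in> set (pawalk_verts t ps)" using pe(2) by (cases ps) auto
    moreover have "distinct (y # w # pawalk_verts t ps)" using p(3) pe(1) by simp
    ultimately have "u \<noteq> w" "y \<noteq> t" by auto
    moreover have "(u, y) \<in> parcs ?S" "(y, w) \<in> parcs ?S" "(w, t) \<in> parcs ?S" using p(1) pe(1) by auto
    ultimately show False using assms(2) by auto
  qed
  moreover have "path_graph (with_proj ?S \<restriction> {v \<in> pverts ?S. \<not> leaf ?S v})"
  proof -
    have "leaf ?S v" if "v \<in> L" for v
    proof -
      have "{e \<in> parcs ?S. fst e = v} = {(v, z)}" using that assms(2) by auto
      then show ?thesis using that unfolding leaf_def out_degree_def out_arcs_def
        by (simp del: star_forest_simps(2))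
    qed
    then have sub: "{v \<in> pverts ?S. \<not> leaf ?S v} \<subseteq> {z}" using fz by auto
    define P where "P = with_proj ?S \<restriction> {v \<in> pverts ?S. \<not> leaf ?S v}"
    have "(x, y) \<notin> arcs_ends P" for x y
    proof
      assume "(x, y) \<in> arcs_ends P"
      then have "(x, y) \<in> parcs ?S" "x \<in> {v \<in> pverts ?S. \<not> leaf ?S v}"
        "y \<in> {v \<in> pverts ?S. \<not> leaf ?S v}"
        unfolding P_def by (auto simp: arcs_ends_conv induce_subgraph_def simp del: star_forest_simps)
      then have "x = z" "y = z" using sub by blast+
      then show False using \<open>(x, y) \<in> parcs ?S\<close> S.no_loops' by blast
    qed
    then have noarcs: "arcs_ends P = {}" by auto
    have "verts P \<subseteq> {z}" using sub unfolding P_def by simp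
    \<comment> \<open>The first case arises when \<open>L\<close> is a singleton: then
      \<open>z\<close> is a leaf too.\<close>
    then consider "verts P = {}" | "verts P = {z}" by blast
    then have "path_graph P"
    proof cases
      case 1
      then show ?thesis unfolding path_graph_def using noarcs by (intro exI[of _ "[]"]) auto
    next
      case 2
      then show ?thesis unfolding path_graph_def using noarcs by (intro exI[of _ "[z]"]) auto
    qed
    then show ?thesis unfolding P_def .
  qed
  ultimately show ?thesis using pg unfolding caterpillar_def simple_tree_def by blast
qed

lemma caterpillar_forest_star_forest:
  assumes "finite L" "L \<inter> f ` L = {}"
  shows "caterpillar_forest (star_forest L f)"
proof -
  define star where "star z = star_forest {c \<in> L. f c = z} (\<lambda>_. z)" for z
  have verts_star: "pverts (star z) = insert z {c \<in> L. f c = z}" if "z \<in> f ` L" for z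
    using that unfolding star_def by auto
  have "\<forall>T\<in>star ` f ` L. caterpillar T"
    unfolding star_def using assms by (auto intro!: caterpillar_star)
  moreover have "disjoint_family_on pverts (star ` f ` L)"
    unfolding disjoint_family_on_def
  proof (intro ballI impI)
    fix S T assume ST: "S \<in> star ` f ` L" "T \<in> star ` f ` L" "S \<noteq> T"
    from ST(1) obtain y where "S = star y" "y \<in> f ` L" by (rule imageE)
    moreover from ST(2) obtain z where "T = star z" "z \<in> f ` L" by (rule imageE)
    ultimately show "pverts S \<inter> pverts T = {}" using assms(2) ST(3) by (auto simp: verts_star)
  qed
  moreover have "pverts (star_forest L f) = (\<Union>T\<in>star ` f ` L. pverts T)"
    by (auto simp: verts_star)
  moreover have "parcs (star_forest L f) = (\<Union>T\<in>star ` f ` L. parcs T)"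
    unfolding star_def
    by (intro equalityI subrelI) (auto simp: star_forest_arc_iff simp del: star_forest_simps(2))
  ultimately show ?thesis
    using pair_graph_star_forest[OF assms] unfolding caterpillar_forest_def by blast
qed

text \<open>The vertices are natural numbers so that labels can serve as positions on the line.
  Centres get intervals of length 1/2 starting at distinct integers, hence disjoint ones.\<close>

lemma interval_graph_star_forest:
  fixes f :: "nat \<Rightarrow> nat"
  assumes "finite L" "L \<inter> f ` L = {}"
  shows "interval_graph (star_forest L f)"
proof -
  \<comment> \<open>A leaf becomes a point inside the interval of its centre; \<open>1 / (v + 3)\<close> keeps these points distinct.\<close>
  define I :: "nat \<Rightarrow> real set" where
    "I v = (if v \<in> L then {f v + 1 / (v + 3)} else {real v..v + 1 / 2})" for v
  have frac: "0 < 1 / (real v + 3)" "1 / (real v + 3) < 1 / 2" for v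
    by (auto simp: field_simps)
  have leaves: "I u \<inter> I v = {}" if "u \<in> L" "v \<in> L" "u \<noteq> v" for u v
  proof -
    have "real (f u) + 1 / (real u + 3) \<noteq> real (f v) + 1 / (real v + 3)"
    proof
      assume eq: "real (f u) + 1 / (real u + 3) = real (f v) + 1 / (real v + 3)"
      then have "f u = f v" using frac[of u] frac[of v] by linarith
      with eq \<open>u \<noteq> v\<close> show False by simp
    qed
    then show ?thesis using that unfolding I_def by auto
  qed
  have leaf_centre: "I u \<inter> I z \<noteq> {} \<longleftrightarrow> f u = z" if "u \<in> L" "z \<notin> L" for u z
  proof -
    have "I u \<inter> I z \<noteq> {} \<longleftrightarrow>
        real z \<le> f u + 1 / (real u + 3) \<and> f u + 1 / (real u + 3) \<le> z + 1 / 2"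
      using that unfolding I_def by (auto simp: add.commute)
    also have "\<dots> \<longleftrightarrow> f u = z" using frac[of u] by (auto; linarith)
    finally show ?thesis .
  qed
  have centres: "I y \<inter> I z = {}" if "y \<notin> L" "z \<notin> L" "y \<noteq> z" for y z
    using that unfolding I_def by auto
  have "(u, v) \<in> parcs (star_forest L f) \<longleftrightarrow> I u \<inter> I v \<noteq> {}"
    if "u \<in> L \<union> f ` L" "v \<in> L \<union> f ` L" "u \<noteq> v" for u v
    using that assms(2) leaves[of u v] leaf_centre[of u v] leaf_centre[of v u] centres[of u v]
    unfolding star_forest_arc_iff by (cases "u \<in> L"; cases "v \<in> L") (auto simp: Int_commute)
  moreover have "is_interval (I v) \<and> I v \<noteq> {}" for v
    unfolding I_def by (auto simp: is_interval_1)
  ultimately show ?thesis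
    using pair_graph_star_forest[OF assms] unfolding interval_graph_def star_forest_simps(1)
    by blast
qed

section \<open>Determining a cover number\<close>

text \<open>An inequality suffices for the given cover, whose members may coincide when it arises as
  an image; equality then follows from \<open>lower\<close>.\<close>

lemma cover_number_eqI:
  assumes "finite \<H>" "card \<H> \<le> m"
    and "\<And>H. H \<in> \<H> \<Longrightarrow> subgraph (with_proj H) (with_proj G) \<and> \<C> H"
    and "(\<Union>H\<in>\<H>. parcs H) = parcs G"
    and lower: "\<And>\<H>. finite \<H> \<Longrightarrow>
      (\<And>H. H \<in> \<H> \<Longrightarrow> subgraph (with_proj H) (with_proj G) \<and> \<C> H) \<Longrightarrow>
      (\<Union>H\<in>\<H>. parcs H) = parcs G \<Longrightarrow> m \<le> card \<H>"
  shows "cover_number \<C> G = m"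
  unfolding cover_number_def
proof (rule Least_equality)
  have "card \<H> = m" using assms by (intro le_antisym) auto
  then show "\<exists>\<H>. finite \<H> \<and> card \<H> = m \<and>
    (\<forall>H\<in>\<H>. subgraph (with_proj H) (with_proj G) \<and> \<C> H) \<and> (\<Union>H\<in>\<H>. parcs H) = parcs G"
    using assms(1,3,4) by blast
next
  fix n
  assume "\<exists>\<H>. finite \<H> \<and> card \<H> = n \<and>
    (\<forall>H\<in>\<H>. subgraph (with_proj H) (with_proj G) \<and> \<C> H) \<and> (\<Union>H\<in>\<H>. parcs H) = parcs G"
  then show "m \<le> n" using lower by blast
qed

section \<open>The layered graph\<close>

text \<open>\<open>s c\<close> is the neighbourhood of \<open>c\<close> in \<open>B\<close>. The
  sizes of \<open>B\<close> and \<open>C\<close> stay open: only the lower bound asks for large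
  layers.\<close>

locale layered_graph =
  fixes A B C :: "nat set" and s :: "nat \<Rightarrow> nat set" and k :: nat
  assumes finite_layers: "finite A" "finite B" "finite C"
    and disjoint: "A \<inter> B = {}" "A \<inter> C = {}" "B \<inter> C = {}"
    and card_A: "card A = k"
    and s_subset: "c \<in> C \<Longrightarrow> s c \<subseteq> B"
    and card_s: "c \<in> C \<Longrightarrow> card (s c) = k"
begin

text \<open>This serves both to generate the edges and as the orientation that bounds the
  degeneracy.\<close>

definition downward_arcs :: "nat rel" where
  "downward_arcs = B \<times> A \<union> Sigma C s"

definition layered :: "nat pair_pre_digraph" where
  "layered = \<lparr> pverts = A \<union> B \<union> C, parcs = downward_arcs \<union> downward_arcs\<inverse> \<rparr>"

lemma layered_simps [simp]:
  "pverts layered = A \<union> B \<union> C" "parcs layered = downward_arcs \<union> downward_arcs\<inverse>"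
  by (simp_all add: layered_def)

lemma downward_arcsD:
  "(u, v) \<in> downward_arcs \<Longrightarrow> u \<in> B \<and> v \<in> A \<or> u \<in> C \<and> v \<in> B \<and> v \<in> s u"
  using s_subset unfolding downward_arcs_def by blast

lemma layered_arcD:
  assumes "(u, v) \<in> parcs layered"
  shows "u \<in> B \<and> v \<in> A \<union> C \<or> v \<in> B \<and> u \<in> A \<union> C"
  using assms by (auto dest!: downward_arcsD)

lemma pair_graph_layered: "pair_graph layered"
proof
  have arcs: "fst e \<in> pverts layered \<and> snd e \<in> pverts layered \<and> fst e \<noteq> snd e"
    if "e \<in> parcs layered" for e
    using layered_arcD[of "fst e" "snd e"] that disjoint by auto
  then show "fst e \<in> pverts layered" "snd e \<in> pverts layered" "fst e \<noteq> snd e"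
    if "e \<in> parcs layered" for e using that by blast+
  have "downward_arcs \<subseteq> (A \<union> B \<union> C) \<times> (A \<union> B \<union> C)"
    by (auto dest: downward_arcsD)
  then have "finite downward_arcs" using finite_layers by (meson finite_SigmaI finite_UnI finite_subset)
  then show "finite (parcs layered)" by simp
  show "finite (pverts layered)" using finite_layers by simp
  show "symmetric (with_proj layered)" unfolding symmetric_def by (auto intro!: symI)
qed

lemma bipartite_layered: "bipartite layered"
  unfolding bipartite_def
proof (intro exI conjI)
  show "pverts layered = B \<union> (A \<union> C)" by auto
  show "B \<inter> (A \<union> C) = {}" using disjoint by blast
  show "parcs layered \<subseteq> B \<times> (A \<union> C) \<union> (A \<union> C) \<times> B"
    by (auto dest!: layered_arcD simp del: layered_simps)
qed

lemma layered_triangle_free: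
  assumes "(a, b) \<in> parcs layered" "(b, c) \<in> parcs layered"
  shows "(a, c) \<notin> parcs layered"
proof
  assume "(a, c) \<in> parcs layered"
  from assms[THEN layered_arcD] this[THEN layered_arcD] show False using disjoint by auto
qed

lemma degeneracy_layered: "degeneracy layered \<le> k"
proof -
  \<comment> \<open>The rank drops along every downward arc, which excludes directed cycles and
    opposite arcs alike.\<close>
  define rank :: "nat \<Rightarrow> nat" where "rank v = (if v \<in> A then 0 else if v \<in> B then 1 else 2)" for v
  have rank: "rank v < rank u" if "(u, v) \<in> downward_arcs" for u v
    using downward_arcsD[OF that] disjoint unfolding rank_def by auto
  have "acyclic_orientation layered downward_arcs"
    unfolding acyclic_orientation_def
  proof (intro conjI)
    show "acyclic downward_arcs" using rank by (rule acyclicI_order)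
    show "downward_arcs \<inter> downward_arcs\<inverse> = {}" by (auto dest!: rank)
  qed simp
  then have "degeneracy layered \<le> max_out_degree (pverts layered) downward_arcs"
    unfolding degeneracy_def by (intro Least_le) blast
  also have "\<dots> \<le> k"
  proof -
    have "card (downward_arcs `` {v}) \<le> k" if "v \<in> A \<union> B \<union> C" for v
    proof -
      have "downward_arcs `` {v} = (if v \<in> B then A else if v \<in> C then s v else {})"
        using disjoint unfolding downward_arcs_def by auto
      then show ?thesis using card_A card_s by auto
    qed
    then show ?thesis unfolding max_out_degree_def using finite_layers by auto
  qed
  finally show ?thesis .
qed

section \<open>Upper bound: a cover by star forests\<close>

lemma star_forest_subgraph:
  assumes "L \<union> f ` L \<subseteq> A \<union> B \<union> C" "\<And>c. c \<in> L \<Longrightarrow> (c, f c) \<in> parcs layered"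
    and "finite L" "L \<inter> f ` L = {}"
  shows "subgraph (with_proj (star_forest L f)) (with_proj layered)"
proof -
  interpret S: pair_graph "star_forest L f" using assms(3,4) by (rule pair_graph_star_forest)
  interpret G: pair_graph layered by (rule pair_graph_layered)
  show ?thesis
    unfolding subgraph_def wf_digraph_wp_iff using assms(1,2) S.pair_wf_digraph G.pair_wf_digraph
    by (auto simp: with_proj_def compatible_def)
qed

lemma star_forest_cover:
  obtains \<H> where "finite \<H>" "card \<H> \<le> 2 * k" "(\<Union>H\<in>\<H>. parcs H) = parcs layered"
    "\<And>H. H \<in> \<H> \<Longrightarrow> subgraph (with_proj H) (with_proj layered) \<and>
      caterpillar_forest H \<and> interval_graph H"
proof -
  \<comment> \<open>Sorting fixes an enumeration of \<open>s c\<close>, so \<open>e c i\<close> is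
    the \<open>i\<close>-th neighbour of \<open>c\<close> in \<open>B\<close>.\<close>
  define e where "e c i = sorted_list_of_set (s c) ! i" for c i
  have e: "(\<lambda>i. e c i) ` {..<k} = s c" if "c \<in> C" for c
  proof -
    have fin: "finite (s c)" using that s_subset finite_layers finite_subset by blast
    then have "length (sorted_list_of_set (s c)) = k" using card_s[OF that] by simp
    then have "(\<lambda>i. e c i) ` {..<k} = set (sorted_list_of_set (s c))"
      unfolding e_def by (auto simp: set_conv_nth)
    then show ?thesis using fin by simp
  qed
  have e_in: "e c i \<in> s c" "e c i \<in> B" "e c i \<notin> C" if "c \<in> C" "i < k" for c i
    using e[OF that(1)] that s_subset disjoint by blast+
  \<comment> \<open>\<open>\<H>1\<close> has one star per vertex of \<open>A\<close>, with leaf set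
    \<open>B\<close>. The \<open>i\<close>-th graph of \<open>\<H>2\<close> hangs every
    \<open>c\<close> on its \<open>i\<close>-th neighbour.\<close>
  define \<H>1 where "\<H>1 = (\<lambda>a. star_forest B (\<lambda>_. a)) ` A"
  define \<H>2 where "\<H>2 = (\<lambda>i. star_forest C (\<lambda>c. e c i)) ` {..<k}"
  show ?thesis
  proof (rule that[of "\<H>1 \<union> \<H>2"])
    show "finite (\<H>1 \<union> \<H>2)" unfolding \<H>1_def \<H>2_def using finite_layers by simp
    have "card \<H>1 \<le> k" "card \<H>2 \<le> k" unfolding \<H>1_def \<H>2_def
      using card_image_le[OF finite_layers(1)] card_A card_image_le[of "{..<k}"] by auto
    then show "card (\<H>1 \<union> \<H>2) \<le> 2 * k" using card_Un_le[of \<H>1 \<H>2] by simp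
    have H1: "(\<Union>H\<in>\<H>1. parcs H) = B \<times> A \<union> A \<times> B"
      unfolding \<H>1_def by auto
    have "(\<Union>H\<in>\<H>2. parcs H) = (\<Union>c\<in>C. \<Union>v\<in>(\<lambda>i. e c i) ` {..<k}. {(c, v), (v, c)})"
      unfolding \<H>2_def by auto
    also have "\<dots> = Sigma C s \<union> (Sigma C s)\<inverse>" using e by auto
    finally show "(\<Union>H\<in>\<H>1 \<union> \<H>2. parcs H) = parcs layered"
      unfolding UN_Un H1 by (auto simp: downward_arcs_def)
    fix H assume "H \<in> \<H>1 \<union> \<H>2"
    then obtain L f where H: "H = star_forest L f" and Lf: "finite L" "L \<inter> f ` L = {}"
      "L \<union> f ` L \<subseteq> A \<union> B \<union> C" "\<And>c. c \<in> L \<Longrightarrow> (c, f c) \<in> parcs layered"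
    proof
      assume "H \<in> \<H>1"
      then obtain a where a: "a \<in> A" "H = star_forest B (\<lambda>_. a)" unfolding \<H>1_def by blast
      show ?thesis
        by (rule that[OF a(2)]) (use a(1) finite_layers disjoint in \<open>auto simp: downward_arcs_def\<close>)
    next
      assume "H \<in> \<H>2"
      then obtain i where i: "i < k" "H = star_forest C (\<lambda>c. e c i)" unfolding \<H>2_def by blast
      show ?thesis
        by (rule that[OF i(2)])
          (use i(1) finite_layers disjoint e_in in \<open>auto simp: downward_arcs_def\<close>)
    qed
    show "subgraph (with_proj H) (with_proj layered) \<and> caterpillar_forest H \<and> interval_graph H"
      unfolding H
      using star_forest_subgraph[OF Lf(3,4,1,2)] caterpillar_forest_star_forest[OF Lf(1,2)]
        interval_graph_star_forest[OF Lf(1,2)] by simp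
  qed
qed

section \<open>Lower bound for covers by thin relations\<close>

text \<open>The constants come from counting with fewer than \<open>2 * k\<close> relations:
  \<open>4 * k * k\<close> bounds the exceptional vertices of \<open>B\<close>, \<open>4 ^ k\<close>
  the sets of relations, and \<open>2 * k * k * k\<close> exceeds the number of triples in
  \<open>S \<times> S \<times> \<R>\<close>.\<close>

lemma card_thin_cover:
  assumes "k \<ge> 1"
    and B_large: "4 * k * k + k * 4 ^ k \<le> card B"
    and C_large: "\<And>S. S \<subseteq> B \<Longrightarrow> card S = k \<Longrightarrow> 2 * k * k * k \<le> card {c \<in> C. s c = S}"
    and fin: "finite \<R>" and thin: "\<And>R. R \<in> \<R> \<Longrightarrow> thin R" and cover: "\<Union>\<R> = parcs layered"
  shows "2 * k \<le> card \<R>"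
proof (rule ccontr)
  assume "\<not> ?thesis"
  then have few: "card \<R> < 2 * k" by simp
  define heavy where "heavy a R = {w. (a, w) \<in> R \<and> (\<exists>u. u \<noteq> a \<and> (w, u) \<in> R)}" for a and R :: "nat rel"
  define Bad where "Bad = (\<Union>a\<in>A. \<Union>R\<in>\<R>. heavy a R)"
  have "card Bad \<le> (\<Sum>a\<in>A. card (\<Union>R\<in>\<R>. heavy a R))"
    unfolding Bad_def by (rule card_UN_le[OF finite_layers(1)])
  also have "\<dots> \<le> (\<Sum>a\<in>A. 2 * card \<R>)"
  proof (rule sum_mono)
    fix a
    have "card (\<Union>R\<in>\<R>. heavy a R) \<le> (\<Sum>R\<in>\<R>. card (heavy a R))" by (rule card_UN_le[OF fin])
    also have "\<dots> \<le> (\<Sum>R\<in>\<R>. 2)"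
      unfolding heavy_def by (intro sum_mono thin_card_le thin)
    finally show "card (\<Union>R\<in>\<R>. heavy a R) \<le> 2 * card \<R>" by simp
  qed
  also have "\<dots> \<le> 4 * k * k" using few card_A by simp
  finally have "card Bad \<le> 4 * k * k" .
  moreover have "card B \<le> card (B - Bad) + card Bad"
  proof -
    \<comment> \<open>The bound on \<open>card Bad\<close> alone would permit an infinite set;
      finiteness comes from the finitely many arcs of \<open>layered\<close>.\<close>
    have "finite Bad"
    proof (rule finite_subset)
      interpret G: pair_graph layered by (rule pair_graph_layered)
      show "finite (snd ` parcs layered)" using G.pair_finite_arcs by (rule finite_imageI)
      show "Bad \<subseteq> snd ` parcs layered"
        unfolding Bad_def heavy_def cover[symmetric] by force
    qed
    then show ?thesis using card_Diff_subset_Int diff_card_le_card_Diff by (metis le_diff_conv)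
  qed
  ultimately have good: "k * 4 ^ k \<le> card (B - Bad)" using B_large by linarith
  \<comment> \<open>\<open>F b\<close> collects the relations used by the edges from
    \<open>b\<close> to \<open>A\<close>; the pigeonhole principle makes it constant on
    \<open>S\<close>.\<close>
  define F where "F b = {R \<in> \<R>. \<exists>a\<in>A. (a, b) \<in> R}" for b
  have "F \<in> B - Bad \<rightarrow> Pow \<R>" unfolding F_def by auto
  then obtain \<F> where \<F>: "card (B - Bad) \<le> card (F -` {\<F>} \<inter> (B - Bad)) * card (Pow \<R>)"
    using pigeonhole_card[of F "B - Bad" "Pow \<R>"] fin finite_layers by auto
  have "card (Pow \<R>) \<le> 4 ^ k"
  proof -
    have "(2::nat) ^ card \<R> \<le> 2 ^ (2 * k)" using few by (intro power_increasing) auto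
    then show ?thesis using fin by (simp add: card_Pow power_mult)
  qed
  then have "k * 4 ^ k \<le> card (F -` {\<F>} \<inter> (B - Bad)) * 4 ^ k"
    using good \<F> by (meson le_trans mult_le_mono2)
  then have "k \<le> card (F -` {\<F>} \<inter> (B - Bad))" by simp
  then obtain S where S: "S \<subseteq> F -` {\<F>} \<inter> (B - Bad)" "card S = k" "finite S"
    by (meson obtain_subset_with_card_n)
  \<comment> \<open>As \<open>b\<close> avoids \<open>Bad\<close>, it is a leaf in each relation
    that joins it to a vertex of \<open>A\<close>.\<close>
  have unique: False if "b \<in> S" "R \<in> \<R>" "a \<in> A" "(a, b) \<in> R" "(b, u) \<in> R" "u \<noteq> a" for a b u R
    using that S(1) unfolding Bad_def heavy_def by blast
  have card_\<F>: "k \<le> card \<F>"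
  proof -
    obtain b where b: "b \<in> S" using S(2) \<open>k \<ge> 1\<close> by fastforce
    have "\<exists>R\<in>\<R>. (a, b) \<in> R" if "a \<in> A" for a
    proof -
      have "(a, b) \<in> parcs layered" using that b S(1) by (auto simp: downward_arcs_def)
      then show ?thesis using cover by blast
    qed
    then obtain r where r: "\<And>a. a \<in> A \<Longrightarrow> r a \<in> \<R> \<and> (a, b) \<in> r a" by metis
    \<comment> \<open>One relation containing the edges from \<open>b\<close> to two vertices of
      \<open>A\<close> would contradict \<open>unique\<close>.\<close>
    have "inj_on r A"
    proof (rule inj_onI)
      fix a a' assume a: "a \<in> A" "a' \<in> A" "r a = r a'"
      then have "(b, a') \<in> r a" using r thin thin_symD by metis
      then show "a = a'" using unique[OF b] r a by metis
    qed
    moreover have "r ` A \<subseteq> F b" using r unfolding F_def by blast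
    moreover have "F b = \<F>" using b S(1) by blast
    moreover have "finite (F b)" using fin unfolding F_def by simp
    ultimately show ?thesis using card_A card_inj_on_le by metis
  qed
  have "\<F> \<subseteq> \<R>"
  proof -
    obtain b where "b \<in> S" using S(2) \<open>k \<ge> 1\<close> by fastforce
    then show ?thesis using S(1) unfolding F_def by blast
  qed
  then have "card (\<R> - \<F>) = card \<R> - card \<F>"
    using fin finite_subset by (metis card_Diff_subset)
  then have rest: "card (\<R> - \<F>) < k" using few card_\<F> by simp
  define X where "X = {c \<in> C. s c = S}"
  have "\<exists>b b' R. b \<in> S \<and> b' \<in> S \<and> R \<in> \<R> \<and> b \<noteq> b' \<and> (b, c) \<in> R \<and> (b', c) \<in> R" if "c \<in> X" for c
  proof -
    have c: "c \<in> C" "s c = S" using that unfolding X_def by auto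
    have "\<exists>R\<in>\<R>. (b, c) \<in> R" if "b \<in> S" for b
    proof -
      have "(b, c) \<in> parcs layered" using that c by (auto simp: downward_arcs_def)
      then show ?thesis using cover by blast
    qed
    then obtain r where r: "\<And>b. b \<in> S \<Longrightarrow> r b \<in> \<R> \<and> (b, c) \<in> r b" by metis
    \<comment> \<open>A relation in \<open>\<F>\<close> already joins \<open>b\<close> to some
      \<open>a\<close> in \<open>A\<close>, and \<open>b\<close> is a leaf there, so it cannot also
      contain the edge to \<open>c\<close>.\<close>
    have "r b \<notin> \<F>" if "b \<in> S" for b
    proof
      assume "r b \<in> \<F>"
      then have "r b \<in> F b" using that S(1) by blast
      then obtain a where "a \<in> A" "(a, b) \<in> r b" unfolding F_def by blast
      then show False using unique[OF that, of "r b" a c] r[OF that] c disjoint by blast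
    qed
    then have "r ` S \<subseteq> \<R> - \<F>" using r by blast
    then have "card (r ` S) < card S" using rest S(2) fin
      by (meson card_mono finite_Diff le_less_trans)
    then have "\<not> inj_on r S" by (rule pigeonhole)
    then show ?thesis using r unfolding inj_on_def by metis
  qed
  then obtain p p' q where h: "\<And>c. c \<in> X \<Longrightarrow> p c \<in> S \<and> p' c \<in> S \<and> q c \<in> \<R> \<and> p c \<noteq> p' c \<and>
      (p c, c) \<in> q c \<and> (p' c, c) \<in> q c" by metis
  \<comment> \<open>\<open>g c\<close> records which two edges at \<open>c\<close> share which
    relation. If \<open>c\<close> and \<open>c'\<close> agree in it, then \<open>p c\<close>,
    \<open>c\<close>, \<open>p' c\<close>, \<open>c'\<close> form a 4-cycle in
    \<open>q c\<close>.\<close>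
  define g where "g c = (p c, p' c, q c)" for c
  have "card (g ` X) \<le> card (S \<times> S \<times> \<R>)"
    using h S(3) fin by (intro card_mono) (auto simp: g_def)
  also have "\<dots> < 2 * k * k * k" using S(2) few \<open>k \<ge> 1\<close> by (simp add: card_cartesian_product)
  also have "\<dots> \<le> card X" unfolding X_def using S by (intro C_large) auto
  finally have "\<not> inj_on g X" by (rule pigeonhole)
  then obtain c c' where c: "c \<in> X" "c' \<in> X" "c \<noteq> c'" "p c = p c'" "p' c = p' c'" "q c = q c'"
    unfolding inj_on_def g_def by auto
  have "thin (q c)" using h[OF c(1)] thin by blast
  then show False
    using thin_no_C4[of "q c" "p c" c "p' c" c'] thin_symD[of "q c"] h[OF c(1)] h[OF c(2)] c by metis
qed

end

section \<open>Existence of large layers and conclusion\<close>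

text \<open>A vertex of \<open>C\<close> encodes a pair of a \<open>k\<close>-subset of
  \<open>B\<close> and a copy number below \<open>N\<close>. Consecutive blocks of natural numbers
  keep the layers disjoint.\<close>

lemma ex_layered_graph:
  obtains A B C s where "layered_graph A B C s k" "card B = n"
    "\<And>S. S \<subseteq> B \<Longrightarrow> card S = k \<Longrightarrow> card {c \<in> C. s c = S} = N"
proof -
  define A B where "A = {..<k}" and "B = {k..<k + n}"
  define X where "X = {S. S \<subseteq> B \<and> card S = k} \<times> {..<N}"
  have "finite B" unfolding B_def by simp
  then have "finite X" unfolding X_def by simp
  then obtain h where h: "bij_betw h {0..<card X} X" using ex_bij_betw_nat_finite by blast
  define C where "C = {k + n..<k + n + card X}"
  \<comment> \<open>\<open>g\<close> decodes a vertex of \<open>C\<close>; the shift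
    \<open>k + n\<close> skips \<open>A\<close> and \<open>B\<close>.\<close>
  define g where "g c = h (c - (k + n))" for c
  define s where "s c = fst (g c)" for c
  have "bij_betw (\<lambda>c. c - (k + n)) C {0..<card X}"
    unfolding C_def by (rule bij_betwI[where g = "\<lambda>i. k + n + i"]) auto
  then have g: "bij_betw g C X"
    using bij_betw_trans[OF _ h] unfolding g_def comp_def by blast
  show ?thesis
  proof (rule that[of A B C s])
    show "layered_graph A B C s k"
    proof
      fix c assume "c \<in> C"
      then have "g c \<in> X" using g bij_betwE by blast
      then show "s c \<subseteq> B" "card (s c) = k" unfolding s_def X_def by auto
    qed (auto simp: A_def B_def C_def)
    show "card B = n" unfolding B_def by simp
    fix S assume S: "S \<subseteq> B" "card S = k"
    have "inj_on g {c \<in> C. s c = S}"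
      using g by (auto simp: bij_betw_def intro: inj_on_subset)
    then have "card {c \<in> C. s c = S} = card (g ` {c \<in> C. s c = S})"
      by (simp add: card_image)
    moreover have "g ` {c \<in> C. s c = S} = {x \<in> X. fst x = S}"
      unfolding s_def bij_betw_imp_surj_on[OF g, symmetric] by blast
    moreover have "{x \<in> X. fst x = S} = {S} \<times> {..<N}"
    proof -
      have iff: "(T, i) \<in> {x \<in> X. fst x = S} \<longleftrightarrow> T = S \<and> i < N" for T i
      proof -
        have "(T, i) \<in> X \<longleftrightarrow> (T \<subseteq> B \<and> card T = k) \<and> i < N"
          unfolding X_def mem_Sigma_iff mem_Collect_eq lessThan_iff ..
        then show ?thesis using S by (cases "T = S") simp_all
      qed
      show ?thesis
        by (intro equalityI subrelI) (simp_all only: iff mem_Sigma_iff singleton_iff lessThan_iff simp_thms)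
    qed
    ultimately show "card {c \<in> C. s c = S} = N"
      by (simp add: card_cartesian_product)
  qed
qed

theorem theorem12:
  fixes k :: nat
  assumes "k \<ge> 1"
  shows "\<exists>G :: nat pair_pre_digraph. pair_graph G \<and> bipartite G \<and>
    2 * degeneracy G \<le> 2 * k \<and> 2 * k \<le> caterpillar_arboricity G \<and>
    caterpillar_arboricity G = track_number G"
proof -
  obtain A B C s where "layered_graph A B C s k" and card_B: "card B = 4 * k * k + k * 4 ^ k"
    and card_C: "\<And>S. S \<subseteq> B \<Longrightarrow> card S = k \<Longrightarrow> card {c \<in> C. s c = S} = 2 * k * k * k"
    by (rule ex_layered_graph[where k = k and n = "4 * k * k + k * 4 ^ k" and N = "2 * k * k * k"])
      (rule that; assumption)
  interpret layered_graph A B C s k by fact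
  have lower: "2 * k \<le> card \<H>"
    if "finite \<H>" "\<And>H. H \<in> \<H> \<Longrightarrow> thin (parcs H)" "(\<Union>H\<in>\<H>. parcs H) = parcs layered"
    for \<H> :: "nat pair_pre_digraph set"
  proof -
    \<comment> \<open>Different subgraphs may have the same arcs, so passing to arc sets can only
      decrease the number.\<close>
    have "2 * k \<le> card (parcs ` \<H>)"
    proof (rule card_thin_cover)
      show "2 * k * k * k \<le> card {c \<in> C. s c = S}" if "S \<subseteq> B" "card S = k" for S
        using card_C that by simp
      show "thin R" if "R \<in> parcs ` \<H>" for R
        using that \<open>\<And>H. H \<in> \<H> \<Longrightarrow> thin (parcs H)\<close> by blast
    qed (use assms that(1,3) card_B in simp_all)
    then show ?thesis using card_image_le[OF that(1)] le_trans by blast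
  qed
  obtain \<H> where \<H>: "finite \<H>" "card \<H> \<le> 2 * k" "(\<Union>H\<in>\<H>. parcs H) = parcs layered"
    "\<And>H. H \<in> \<H> \<Longrightarrow> subgraph (with_proj H) (with_proj layered) \<and>
      caterpillar_forest H \<and> interval_graph H"
    by (rule star_forest_cover) (rule that; assumption)
  have "caterpillar_arboricity layered = 2 * k"
    unfolding caterpillar_arboricity_def
  proof (rule cover_number_eqI[OF \<H>(1,2) _ \<H>(3)])
    fix \<K>
    assume \<K>: "finite \<K>" "(\<Union>H\<in>\<K>. parcs H) = parcs layered"
      "\<And>H. H \<in> \<K> \<Longrightarrow> subgraph (with_proj H) (with_proj layered) \<and> caterpillar_forest H"
    then show "2 * k \<le> card \<K>" by (intro lower thin_caterpillar_forest) simp_all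
  qed (simp add: \<H>(4))
  moreover have "track_number layered = 2 * k"
    unfolding track_number_def
  proof (rule cover_number_eqI[OF \<H>(1,2) _ \<H>(3)])
    fix \<K>
    assume \<K>: "finite \<K>" "(\<Union>H\<in>\<K>. parcs H) = parcs layered"
      "\<And>H. H \<in> \<K> \<Longrightarrow> subgraph (with_proj H) (with_proj layered) \<and> interval_graph H"
    have "thin (parcs H)" if "H \<in> \<K>" for H
    proof (rule thin_interval_graph)
      show "interval_graph H" using \<K>(3)[OF that] by simp
      \<comment> \<open>Interval graphs may contain triangles in general; those in the cover inherit
        triangle-freeness from \<open>layered\<close>.\<close>
      have sub: "parcs H \<subseteq> parcs layered" using UN_upper[OF that, of parcs] \<K>(2) by simp
      fix a b c
      assume "(a, b) \<in> parcs H" "(b, c) \<in> parcs H"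
      then have "(a, c) \<notin> parcs layered" by (meson layered_triangle_free sub subsetD)
      then show "(a, c) \<notin> parcs H" using sub by (meson subsetD)
    qed
    then show "2 * k \<le> card \<K>" by (intro lower \<K>(1,2))
  qed (simp add: \<H>(4))
  ultimately show ?thesis
    using pair_graph_layered bipartite_layered degeneracy_layered
    by (intro exI[of _ layered]) (simp del: layered_simps)
qed

end
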